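(* Let $\Gamma$ be a connected simplicial graph, $Y$ a connected full subgraph of $\Gamma$, and let $\varphi : Y^{\infty} = \bigcup_{i\in\mathbb{N}} Y^i \to \Gamma$ be an edge-preserving map such that there exists an automorphism $\phi \in \mathrm{Aut}(\Gamma)$ with $\phi|_Y = \varphi|_Y$. Then $\varphi = \phi|_{Y^\infty}$, and any other $\psi\in\mathrm{Aut}(\Gamma)$ with $\varphi = \psi|_{Y^\infty}$ differs from $\phi$ by an element of $\mathrm{stab}_{pt}(Y)$.
   Context: For a simplicial graph $\Gamma$, $\mathcal{V}(\Gamma)$ denotes its vertex set, and the link of a vertex $w$ is the full subgraph spanned by the vertices adjacent to $w$. A vertex $v$ is uniquely determined by a set $B\subset\mathcal{V}(\Gamma)$, written $v=\langle B\rangle$, if $v$ is the unique vertex adjacent to every element of $B$, i.e. $\{v\}=\bigcap_{w\in B}\mathrm{link}(w)$ (as vertex sets). For a full subgraph $Y$ of $\Gamma$, the first rigid expansion $Y^1$ is the full subgraph spanned by $\mathcal{V}(Y)\cup\{v : v=\langle B\rangle,\ B\subset\mathcal{V}(Y)\}$; set $Y^0=Y$, $Y^k=(Y^{k-1})^1$, and let $Y^\infty$ be the full subgraph spanned by $\bigcup_{i\in\mathbb{N}}\mathcal{V}(Y^i)$. An edge-preserving map is a graph homomorphism: a map on vertices sending any two adjacent vertices to adjacent vertices. $\mathrm{stab}_{pt}(Y)$ is the pointwise stabilizer of $Y$ in $\mathrm{Aut}(\Gamma)$; "$\psi$ differs from $\phi$ by an element of $\mathrm{stab}_{pt}(Y)$"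 means $\phi^{-1}\psi\in\mathrm{stab}_{pt}(Y)$. *)

theory Defs
  imports
    "Graph_Theory.Digraph_Component"
    "Graph_Theory.Digraph_Isomorphism"
    "HOL-Algebra.Bij"
begin

text \<open>
  Undirected graphs are symmetric digraphs, as in the library, but the vertex set may be
  infinite (the library's locale \<^locale>\<open>graph\<close> assumes finiteness). Adjacency of
  \<open>u\<close> and \<open>v\<close> is \<open>u \<rightarrow>\<^bsub>G\<^esub> v\<close>.
\<close>

locale simplicial_graph = loopfree_digraph G + nomulti_digraph G + sym_digraph G
  for G :: "('a, 'b) pre_digraph" (structure)

definition link :: "('a, 'b) pre_digraph \<Rightarrow> 'a \<Rightarrow> ('a, 'b) pre_digraph" where
  "link G w = G \<restriction> {v. w \<rightarrow>\<^bsub>G\<^esub> v}"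

text \<open>
  The intersection of links is taken inside the vertex set, so that for \<open>B = {}\<close> it is
  \<^term>\<open>verts G\<close> and not \<^term>\<open>UNIV\<close>.
\<close>

definition uniquely_determined :: "('a, 'b) pre_digraph \<Rightarrow> 'a \<Rightarrow> 'a set \<Rightarrow> bool" where
  "uniquely_determined G v B \<longleftrightarrow>
     B \<subseteq> verts G \<and> {v} = verts G \<inter> (\<Inter>w\<in>B. verts (link G w))"

definition rigid_expansion ::
    "('a, 'b) pre_digraph \<Rightarrow> ('a, 'b) pre_digraph \<Rightarrow> ('a, 'b) pre_digraph" where
  "rigid_expansion G Y =
     G \<restriction> (verts Y \<union> {v. \<exists>B \<subseteq> verts Y. uniquely_determined G v B})"

definition iter_rigid_expansion ::
    "('a, 'b) pre_digraph \<Rightarrow> ('a, 'b) pre_digraph \<Rightarrow> nat \<Rightarrow> ('a, 'b) pre_digraph" where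
  "iter_rigid_expansion G Y k = (rigid_expansion G ^^ k) Y"

definition rigid_expansion_infinity ::
    "('a, 'b) pre_digraph \<Rightarrow> ('a, 'b) pre_digraph \<Rightarrow> ('a, 'b) pre_digraph" where
  "rigid_expansion_infinity G Y = G \<restriction> (\<Union>i. verts (iter_rigid_expansion G Y i))"

definition edge_preserving ::
    "('a, 'b) pre_digraph \<Rightarrow> ('c, 'd) pre_digraph \<Rightarrow> ('a \<Rightarrow> 'c) \<Rightarrow> bool" where
  "edge_preserving H G f \<longleftrightarrow>
     f \<in> verts H \<rightarrow> verts G \<and> (\<forall>u v. u \<rightarrow>\<^bsub>H\<^esub> v \<longrightarrow> f u \<rightarrow>\<^bsub>G\<^esub> f v)"

text \<open>
  Automorphisms act on vertices only; without multiple arcs they determine the action on arcs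
  (see the lemma \<open>Aut_iff_digraph_isomorphism\<close>). As in \<^const>\<open>BijGroup\<close>, elements are
  extensional, i.e. equal to \<^const>\<open>undefined\<close> outside \<^term>\<open>verts G\<close>,
  and the product is composition.
\<close>

definition Aut :: "('a, 'b) pre_digraph \<Rightarrow> ('a \<Rightarrow> 'a) monoid" where
  "Aut G = (BijGroup (verts G))
     \<lparr>carrier := {f \<in> Bij (verts G).
        \<forall>u \<in> verts G. \<forall>v \<in> verts G. f u \<rightarrow>\<^bsub>G\<^esub> f v \<longleftrightarrow> u \<rightarrow>\<^bsub>G\<^esub> v}\<rparr>"

definition stab_pt ::
    "('a, 'b) pre_digraph \<Rightarrow> ('a, 'b) pre_digraph \<Rightarrow> ('a \<Rightarrow> 'a) set" where
  "stab_pt G Y = {f \<in> carrier (Aut G). \<forall>v \<in> verts Y. f v = v}"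

lemma carrier_Aut:
  "f \<in> carrier (Aut G) \<longleftrightarrow> f \<in> extensional (verts G) \<and> bij_betw f (verts G) (verts G) \<and>
     (\<forall>u \<in> verts G. \<forall>v \<in> verts G. f u \<rightarrow>\<^bsub>G\<^esub> f v \<longleftrightarrow> u \<rightarrow>\<^bsub>G\<^esub> v)"
  by (auto simp: Aut_def Bij_def)

lemma subgroup_Aut: "subgroup (carrier (Aut G)) (BijGroup (verts G))"
proof -
  let ?V = "verts G"
  show ?thesis
  proof (rule group.subgroupI[OF group_BijGroup])
    show "carrier (Aut G) \<subseteq> carrier (BijGroup ?V)"
      by (auto simp: Aut_def BijGroup_def)
    have "(\<lambda>x\<in>?V. x) \<in> carrier (Aut G)"
      by (auto simp: carrier_Aut bij_betw_def inj_on_def)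
    then show "carrier (Aut G) \<noteq> {}" by blast
  next
    fix f assume f: "f \<in> carrier (Aut G)"
    then have fB: "f \<in> Bij ?V" by (simp add: Aut_def)
    have bij: "bij_betw f ?V ?V" using f by (simp add: carrier_Aut)
    have inv_in: "inv_into ?V f x \<in> ?V" if "x \<in> ?V" for x
      using bij that by (metis bij_betw_imp_surj_on inv_into_into)
    have f_inv: "f (inv_into ?V f x) = x" if "x \<in> ?V" for x
      using bij that by (rule bij_betw_inv_into_right)
    have "(\<lambda>x\<in>?V. inv_into ?V f x) \<in> carrier (Aut G)"
      unfolding carrier_Aut
    proof (intro conjI ballI)
      show "bij_betw (\<lambda>x\<in>?V. inv_into ?V f x) ?V ?V"
        using bij_betw_inv_into[OF bij] by (simp cong: bij_betw_cong)
      fix u v assume "u \<in> ?V" "v \<in> ?V"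
      then show "(\<lambda>x\<in>?V. inv_into ?V f x) u \<rightarrow>\<^bsub>G\<^esub> (\<lambda>x\<in>?V. inv_into ?V f x) v
          \<longleftrightarrow> u \<rightarrow>\<^bsub>G\<^esub> v"
        using f inv_in f_inv by (auto simp: carrier_Aut) metis+
    qed simp
    then show "inv\<^bsub>BijGroup ?V\<^esub> f \<in> carrier (Aut G)"
      using fB by (simp add: inv_BijGroup)
  next
    fix f g assume fg: "f \<in> carrier (Aut G)" "g \<in> carrier (Aut G)"
    then have B: "f \<in> Bij ?V" "g \<in> Bij ?V" by (simp_all add: Aut_def)
    have maps: "g x \<in> ?V" if "x \<in> ?V" for x
      using fg(2) that by (auto simp: carrier_Aut bij_betw_def)
    have "compose ?V f g \<in> carrier (Aut G)"
      using compose_Bij[OF B] fg maps by (auto simp: Aut_def compose_def)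
    then show "f \<otimes>\<^bsub>BijGroup ?V\<^esub> g \<in> carrier (Aut G)"
      using B by (simp add: BijGroup_def)
  qed
qed

lemma group_Aut: "group (Aut G)"
proof -
  have "(BijGroup (verts G))\<lparr>carrier := carrier (Aut G)\<rparr> = Aut G"
    by (simp add: Aut_def)
  with group.subgroup_imp_group[OF group_BijGroup subgroup_Aut[of G]] show ?thesis
    by (simp only:)
qed

lemma (in simplicial_graph) Aut_iff_digraph_isomorphism:
  "f \<in> carrier (Aut G) \<longleftrightarrow> f \<in> extensional (verts G) \<and>
     (\<exists>h. digraph_isomorphism h \<and> app_iso h G = G \<and> iso_verts h = f)"
proof (intro iffI conjI; (elim conjE exE)?)
  assume f: "f \<in> carrier (Aut G)"
  then show "f \<in> extensional (verts G)" by (simp add: carrier_Aut)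
  have bij: "bij_betw f (verts G) (verts G)"
    and adj: "\<And>u v. u \<in> verts G \<Longrightarrow> v \<in> verts G \<Longrightarrow> f u \<rightarrow> f v \<longleftrightarrow> u \<rightarrow> v"
    using f by (auto simp: carrier_Aut)
  define k where "k = (\<lambda>a. SOME b. b \<in> arcs G \<and> tail G b = f (tail G a) \<and> head G b = f (head G a))"
  have k: "k a \<in> arcs G \<and> tail G (k a) = f (tail G a) \<and> head G (k a) = f (head G a)"
    if a: "a \<in> arcs G" for a
  proof -
    have "tail G a \<rightarrow> head G a" using a by (auto simp: arcs_ends_def arc_to_ends_def)
    then have "f (tail G a) \<rightarrow> f (head G a)" using adj a by simp
    then have "\<exists>b. b \<in> arcs G \<and> tail G b = f (tail G a) \<and> head G b = f (head G a)"
      by (auto simp: arcs_ends_def arc_to_ends_def)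
    then show ?thesis unfolding k_def by (rule someI_ex)
  qed
  have inj_f: "inj_on f (verts G)" using bij by (simp add: bij_betw_def)
  have inj_k: "inj_on k (arcs G)"
  proof (rule inj_onI)
    fix a b assume ab: "a \<in> arcs G" "b \<in> arcs G" "k a = k b"
    then have "f (tail G a) = f (tail G b)" "f (head G a) = f (head G b)"
      using k[of a] k[of b] by auto
    then have "arc_to_ends G a = arc_to_ends G b"
      using inj_f ab by (auto simp: arc_to_ends_def dest: inj_onD)
    then show "a = b" using no_multi_arcs ab by blast
  qed
  have surj_k: "k ` arcs G = arcs G"
  proof (intro equalityI subsetI)
    fix b assume "b \<in> k ` arcs G" then show "b \<in> arcs G" using k by auto
  next
    fix b assume b: "b \<in> arcs G"
    have "tail G b \<in> f ` verts G" "head G b \<in> f ` verts G"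
      using bij b by (simp_all add: bij_betw_def)
    then obtain u v where uv: "u \<in> verts G" "v \<in> verts G" "f u = tail G b" "f v = head G b"
      by (metis imageE)
    have "tail G b \<rightarrow> head G b" using b by (auto simp: arcs_ends_def arc_to_ends_def)
    then have "u \<rightarrow> v" using adj uv by metis
    then obtain a where a: "a \<in> arcs G" "tail G a = u" "head G a = v" by blast
    then have "arc_to_ends G (k a) = arc_to_ends G b"
      using k[of a] uv by (simp add: arc_to_ends_def)
    then have "k a = b" using no_multi_arcs k a b by blast
    then show "b \<in> k ` arcs G" using a by blast
  qed
  let ?h = "\<lparr>iso_verts = f, iso_arcs = k, iso_head = head G, iso_tail = tail G\<rparr>"
  have "digraph_isomorphism ?h"
    using k inj_f inj_k wf_digraph by (auto simp: digraph_isomorphism_def)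
  moreover have "app_iso ?h G = G"
    using surj_k bij by (auto simp: app_iso_def bij_betw_def)
  ultimately show "\<exists>h. digraph_isomorphism h \<and> app_iso h G = G \<and> iso_verts h = f"
    by (intro exI[of _ ?h]) simp
next
  fix h assume ext: "f \<in> extensional (verts G)" and h: "digraph_isomorphism h"
    and G: "app_iso h G = G" and f: "iso_verts h = f"
  have V: "f ` verts G = verts G"
    using arg_cong[OF G, of verts] f by simp
  have A: "iso_arcs h ` arcs G = arcs G"
    using arg_cong[OF G, of arcs] by simp
  have t: "iso_tail h = tail G" and hd: "iso_head h = head G"
    using arg_cong[OF G, of tail] arg_cong[OF G, of head] by simp_all
  have inj: "inj_on f (verts G)" using h f by (simp add: digraph_isomorphism_def)
  have ta: "tail G (iso_arcs h a) = f (tail G a)" and ha: "head G (iso_arcs h a) = f (head G a)"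
    if "a \<in> arcs G" for a
    using h f t hd that by (auto simp: digraph_isomorphism_def)
  have "f u \<rightarrow> f v \<longleftrightarrow> u \<rightarrow> v" if uv: "u \<in> verts G" "v \<in> verts G" for u v
  proof
    assume "u \<rightarrow> v"
    then obtain a where "a \<in> arcs G" "tail G a = u" "head G a = v" by blast
    then have "iso_arcs h a \<in> arcs G" "arc_to_ends G (iso_arcs h a) = (f u, f v)"
      using A ta ha by (auto simp: arc_to_ends_def)
    then show "f u \<rightarrow> f v" unfolding arcs_ends_def by (metis imageI)
  next
    assume "f u \<rightarrow> f v"
    then obtain b where b: "b \<in> arcs G" "tail G b = f u" "head G b = f v" by blast
    then obtain a where a: "a \<in> arcs G" "b = iso_arcs h a" using A by blast
    then have "f (tail G a) = f u" "f (head G a) = f v" using b ta ha by auto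
    then have "tail G a = u" "head G a = v" using inj uv a by (auto dest: inj_onD)
    then show "u \<rightarrow> v" using a by (auto simp: arcs_ends_def arc_to_ends_def)
  qed
  then show "f \<in> carrier (Aut G)"
    using ext V inj by (simp add: carrier_Aut bij_betw_def)
qed

end

theory Submission
  imports Defs
begin

text \<open>
  If \<open>v = \<langle>B\<rangle>\<close> and an edge-preserving map agrees on \<open>B\<close> with an automorphism \<open>\<phi>\<close>, it sends \<open>v\<close>
  to a common neighbour of \<open>\<phi> ` B\<close>; the automorphism transports uniqueness, so this neighbour is
  \<open>\<phi> v\<close>. Hence agreement spreads from each rigid expansion to the next. Two automorphisms
  that agree on \<open>Y\<close> differ by a pointwise stabilizer of \<open>Y\<close> by injectivity.
\<close>

lemma uniquely_determined_iff:
  "uniquely_determined G v B \<longleftrightarrow> B \<subseteq> verts G \<and>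
     (\<forall>u. u \<in> verts G \<and> (\<forall>w\<in>B. w \<rightarrow>\<^bsub>G\<^esub> u) \<longleftrightarrow> u = v)"
  by (auto simp: uniquely_determined_def link_def)

lemma iter_rigid_expansion_0: "iter_rigid_expansion G Y 0 = Y"
  by (simp add: iter_rigid_expansion_def)

lemma verts_iter_rigid_expansion_Suc:
  "verts (iter_rigid_expansion G Y (Suc k)) = verts (iter_rigid_expansion G Y k) \<union>
     {v. \<exists>B \<subseteq> verts (iter_rigid_expansion G Y k). uniquely_determined G v B}"
  by (simp add: iter_rigid_expansion_def rigid_expansion_def)

lemma verts_rigid_expansion_infinity:
  "verts (rigid_expansion_infinity G Y) = (\<Union>i. verts (iter_rigid_expansion G Y i))"
  by (simp add: rigid_expansion_infinity_def)

text \<open>An edge-preserving map on the infinite expansion is only known to respect arcs of that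
  induced subgraph, so adjacencies found in \<open>G\<close> have to be moved into it first.\<close>

lemma adj_induce_subgraph:
  assumes "u \<rightarrow>\<^bsub>G\<^esub> v" "u \<in> S" "v \<in> S"
  shows "u \<rightarrow>\<^bsub>G \<restriction> S\<^esub> v"
  using assms by (force simp: arcs_ends_def arc_to_ends_def)

lemma Aut_image_uniquely_determined:
  assumes "\<phi> \<in> carrier (Aut G)" and "uniquely_determined G v B"
  shows "uniquely_determined G (\<phi> v) (\<phi> ` B)"
proof -
  have bij: "bij_betw \<phi> (verts G) (verts G)"
    and adj: "\<And>u v. u \<in> verts G \<Longrightarrow> v \<in> verts G \<Longrightarrow> \<phi> u \<rightarrow>\<^bsub>G\<^esub> \<phi> v \<longleftrightarrow> u \<rightarrow>\<^bsub>G\<^esub> v"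
    using assms(1) by (auto simp: carrier_Aut)
  have B: "B \<subseteq> verts G"
    and v: "\<And>u. u \<in> verts G \<and> (\<forall>w\<in>B. w \<rightarrow>\<^bsub>G\<^esub> u) \<longleftrightarrow> u = v"
    using assms(2) unfolding uniquely_determined_iff by blast+
  have "x \<in> verts G \<and> (\<forall>w\<in>B. \<phi> w \<rightarrow>\<^bsub>G\<^esub> x) \<longleftrightarrow> x = \<phi> v" for x
  proof
    assume x: "x \<in> verts G \<and> (\<forall>w\<in>B. \<phi> w \<rightarrow>\<^bsub>G\<^esub> x)"
    then obtain y where y: "y \<in> verts G" "x = \<phi> y"
      using bij by (auto simp: bij_betw_def)
    have "w \<rightarrow>\<^bsub>G\<^esub> y" if "w \<in> B" for w
      using x y that B adj[of w y] by auto
    then have "y = v" using y(1) v[of y] by simp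
    with y show "x = \<phi> v" by simp
  next
    assume x: "x = \<phi> v"
    \<comment> \<open>The characterization of \<open>v\<close>, taken at \<open>v\<close> itself,
      makes it a vertex and a common neighbour.\<close>
    have vG: "v \<in> verts G" and vB: "\<forall>w\<in>B. w \<rightarrow>\<^bsub>G\<^esub> v" using v[of v] by simp_all
    have "\<phi> w \<rightarrow>\<^bsub>G\<^esub> \<phi> v" if "w \<in> B" for w
      using that vB B adj[of w v] vG by auto
    then show "x \<in> verts G \<and> (\<forall>w\<in>B. \<phi> w \<rightarrow>\<^bsub>G\<^esub> x)"
      using x bij_betwE[OF bij] vG by simp
  qed
  moreover have "\<phi> ` B \<subseteq> verts G" using B bij_betwE[OF bij] by blast
  ultimately show ?thesis by (simp add: uniquely_determined_iff)
qed

text \<open>Every vertex of the union lies in some finite stage, so induction on the stage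
  suffices.\<close>

lemma edge_preserving_eq_Aut:
  assumes f: "edge_preserving (rigid_expansion_infinity G Y) G f"
    and \<phi>: "\<phi> \<in> carrier (Aut G)" and Y: "\<forall>v \<in> verts Y. \<phi> v = f v"
    and v: "v \<in> verts (rigid_expansion_infinity G Y)"
  shows "f v = \<phi> v"
proof -
  let ?I = "rigid_expansion_infinity G Y"
  let ?Y = "iter_rigid_expansion G Y"
  have sub: "verts (?Y k) \<subseteq> verts ?I" for k
    by (auto simp: verts_rigid_expansion_infinity)
  have "\<forall>v \<in> verts (?Y k). f v = \<phi> v" for k
  proof (induction k)
    case 0
    then show ?case using Y by (simp add: iter_rigid_expansion_0)
  next
    case (Suc k)
    \<comment> \<open>Vertices of the previous stage are covered by the induction hypothesis; only
      the added ones require an argument.\<close>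
    have "f v = \<phi> v" if B: "B \<subseteq> verts (?Y k)" and v: "uniquely_determined G v B" for v B
    proof -
      have "v \<in> verts (?Y (Suc k))" using B v by (auto simp: verts_iter_rigid_expansion_Suc)
      then have vI: "v \<in> verts ?I" using sub by blast
      have "f w \<rightarrow>\<^bsub>G\<^esub> f v" if w: "w \<in> B" for w
      proof -
        have "w \<rightarrow>\<^bsub>G\<^esub> v" using v w by (auto simp: uniquely_determined_iff)
        moreover have "w \<in> verts ?I" using w B sub by blast
        ultimately have "w \<rightarrow>\<^bsub>?I\<^esub> v"
          using vI adj_induce_subgraph[where S = "verts ?I"]
          by (simp add: rigid_expansion_infinity_def)
        then show ?thesis using f by (auto simp: edge_preserving_def)
      qed
      then have "\<forall>w \<in> \<phi> ` B. w \<rightarrow>\<^bsub>G\<^esub> f v" using Suc B by fastforce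
      moreover have "f v \<in> verts G" using f vI by (auto simp: edge_preserving_def)
      ultimately show ?thesis
        using iffD1[OF uniquely_determined_iff Aut_image_uniquely_determined[OF \<phi> v]]
        by (metis (no_types))
    qed
    with Suc show ?case by (auto simp: verts_iter_rigid_expansion_Suc)
  qed
  then show ?thesis using v by (auto simp: verts_rigid_expansion_infinity)
qed

text \<open>The product is the extensional \<open>compose\<close>, so it evaluates as a composition
  at vertices of \<open>G\<close>.\<close>

lemma Aut_mult_apply:
  assumes "g \<in> carrier (Aut G)" "h \<in> carrier (Aut G)" "v \<in> verts G"
  shows "(g \<otimes>\<^bsub>Aut G\<^esub> h) v = g (h v)"
  using assms by (simp add: Aut_def BijGroup_def compose_def)

text \<open>The inverse is never evaluated pointwise: the quotient \<open>h\<close> satisfies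
  \<open>\<phi> (h v) = \<psi> v = \<phi> v\<close> on \<open>Y\<close>, and \<open>\<phi>\<close>
  is cancelled by injectivity.\<close>

lemma inv_mult_in_stab_pt:
  assumes \<phi>: "\<phi> \<in> carrier (Aut G)" and \<psi>: "\<psi> \<in> carrier (Aut G)"
    and Y: "verts Y \<subseteq> verts G" and eq: "\<forall>v \<in> verts Y. \<phi> v = \<psi> v"
  shows "inv\<^bsub>Aut G\<^esub> \<phi> \<otimes>\<^bsub>Aut G\<^esub> \<psi> \<in> stab_pt G Y"
proof -
  interpret group "Aut G" by (rule group_Aut)
  define h where "h = inv\<^bsub>Aut G\<^esub> \<phi> \<otimes>\<^bsub>Aut G\<^esub> \<psi>"
  have h: "h \<in> carrier (Aut G)" using \<phi> \<psi> by (simp add: h_def)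
  have \<phi>h: "\<phi> \<otimes>\<^bsub>Aut G\<^esub> h = \<psi>"
    using \<phi> \<psi> by (simp add: h_def m_assoc[symmetric])
  have "h v = v" if v: "v \<in> verts Y" for v
  proof -
    have vG: "v \<in> verts G" using v Y by blast
    then have "\<phi> (h v) = \<phi> v" using Aut_mult_apply[OF \<phi> h vG] \<phi>h eq v by simp
    \<comment> \<open>Injectivity of \<open>\<phi>\<close> holds on \<open>verts G\<close>, so
      \<open>h v\<close> must be placed there.\<close>
    moreover have "h v \<in> verts G" using h vG by (auto simp: carrier_Aut bij_betw_def)
    ultimately show ?thesis using \<phi> vG by (auto simp: carrier_Aut bij_betw_def dest: inj_onD)
  qed
  with h show ?thesis by (simp add: stab_pt_def h_def)
qed

theorem theorem2:
  fixes G Y :: "('a, 'b) pre_digraph" and f \<phi> :: "'a \<Rightarrow> 'a"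
  assumes "simplicial_graph G" and "connected G"
    and "induced_subgraph Y G" and "connected Y"
    and "edge_preserving (rigid_expansion_infinity G Y) G f"
    and "\<phi> \<in> carrier (Aut G)" and "\<forall>v \<in> verts Y. \<phi> v = f v"
  shows "(\<forall>v \<in> verts (rigid_expansion_infinity G Y). f v = \<phi> v) \<and>
    (\<forall>\<psi> \<in> carrier (Aut G). (\<forall>v \<in> verts (rigid_expansion_infinity G Y). f v = \<psi> v) \<longrightarrow>
       inv\<^bsub>Aut G\<^esub> \<phi> \<otimes>\<^bsub>Aut G\<^esub> \<psi> \<in> stab_pt G Y)"
proof (intro conjI ballI impI)
  show "f v = \<phi> v" if "v \<in> verts (rigid_expansion_infinity G Y)" for v
    using edge_preserving_eq_Aut[OF assms(5-7) that] .
  fix \<psi> assume \<psi>: "\<psi> \<in> carrier (Aut G)"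
    and eq: "\<forall>v \<in> verts (rigid_expansion_infinity G Y). f v = \<psi> v"
  \<comment> \<open>\<open>Y\<close> is stage 0 of the union, so both automorphisms agree with
    \<open>f\<close> on it.\<close>
  have "verts Y \<subseteq> verts (rigid_expansion_infinity G Y)"
    using UN_upper[of 0 UNIV "\<lambda>i. verts (iter_rigid_expansion G Y i)"]
    by (simp add: verts_rigid_expansion_infinity iter_rigid_expansion_0)
  then have "\<forall>v \<in> verts Y. \<phi> v = \<psi> v" using eq assms(7) by auto
  moreover have "verts Y \<subseteq> verts G"
    using assms(3) by (auto simp: induced_subgraph_def subgraph_def)
  ultimately show "inv\<^bsub>Aut G\<^esub> \<phi> \<otimes>\<^bsub>Aut G\<^esub> \<psi> \<in> stab_pt G Y"
    using inv_mult_in_stab_pt[OF assms(6) \<psi>] by blast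
qed

end
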